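(* Let $\theta_0\in(0,\pi/2)$ and let $M\subset\{re^{i\theta}\in\mathbb{C}: r\in(0,1],\ |\theta|<\pi/2\}$ be such that $\Gamma:=\{e^{i\theta}:|\theta|<\theta_0\}\subset\partial M$, where $M$ carries the Euclidean metric. Let $0<\theta_1\le\theta_0$, let $\epsilon>0$ be so small that $\Omega:=\{re^{i\theta}: 1-\epsilon<r<1,\ |\theta|<\theta_1\}\subset M$, let $T\in\mathbb{R}$ and $s>0$, and set $U=(T-s,T+s)\times\Omega$. Then, for each integer $k\ge1$, there is no constant $C>0$ such that the Lipschitz stability estimate $$\|u\|_{H^k(U)}\le C\,\|(u,\partial_\nu u)\|_{H^k((T-s,T+s)\times\Gamma)\times H^{k-1}((T-s,T+s)\times\Gamma)}$$ holds for all smooth complex-valued solutions $u$ of $(\partial_t^2-\Delta)u=0$ on $\mathbb{R}\times M$.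
   Context: $M$ is a compact domain in $\mathbb{R}^2\cong\mathbb{C}$ with smooth boundary $\partial M$ (boundary points are included in $M$; in particular $0\notin M$). $\Delta$ is the Euclidean Laplacian and $\partial_\nu$ is the outward unit normal derivative on $\partial M$. *)

theory Defs
  imports "HOL-Analysis.Analysis"
begin

definition dir_deriv ::
    "'a \<Rightarrow> ('a::real_normed_vector \<Rightarrow> 'b::real_normed_vector) \<Rightarrow> 'a \<Rightarrow> 'b"
  where "dir_deriv v f = (\<lambda>x. frechet_derivative f (at x) v)"

text \<open>\<open>C_on n S f\<close> is meant for open \<open>S\<close>.\<close>

fun C_on :: "nat \<Rightarrow> 'a::real_normed_vector set \<Rightarrow> ('a \<Rightarrow> 'b::real_normed_vector) \<Rightarrow> bool"
  where
    "C_on 0 S f \<longleftrightarrow> continuous_on S f"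
  | "C_on (Suc n) S f \<longleftrightarrow>
       (\<forall>x\<in>S. f differentiable (at x)) \<and> (\<forall>v. C_on n S (dir_deriv v f))"

definition smooth_on :: "'a::real_normed_vector set \<Rightarrow> ('a \<Rightarrow> 'b::real_normed_vector) \<Rightarrow> bool"
  where "smooth_on S f \<longleftrightarrow> (\<forall>n. C_on n S f)"

text \<open>Smoothness on a set that need not be open (for a closed domain: smoothness up to
  the boundary).\<close>

definition smooth_upto :: "'a::real_normed_vector set \<Rightarrow> ('a \<Rightarrow> 'b::real_normed_vector) \<Rightarrow> bool"
  where "smooth_upto A f \<longleftrightarrow>
    (\<exists>W g. open W \<and> A \<subseteq> W \<and> smooth_on W g \<and> (\<forall>x\<in>A. g x = f x))"

text \<open>Near \<open>p\<close> the set \<open>M\<close> is the sublevel set of the smooth function \<open>\<rho>\<close>, whose gradient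
  \<open>g\<close> at \<open>p\<close> does not vanish; so \<open>g\<close> points out of \<open>M\<close>.\<close>

definition local_defining_function ::
    "'a::euclidean_space set \<Rightarrow> 'a \<Rightarrow> ('a \<Rightarrow> real) \<Rightarrow> 'a \<Rightarrow> bool"
  where "local_defining_function M p \<rho> g \<longleftrightarrow>
    (\<exists>V. open V \<and> p \<in> V \<and> smooth_on V \<rho> \<and> M \<inter> V = {x \<in> V. \<rho> x \<le> 0})
    \<and> \<rho> p = 0 \<and> GDERIV \<rho> p :> g \<and> g \<noteq> 0"

definition compact_smooth_domain :: "'a::euclidean_space set \<Rightarrow> bool"
  where "compact_smooth_domain M \<longleftrightarrow>
    compact M \<and> connected M \<and> M \<noteq> {} \<and>
    (\<forall>p\<in>frontier M. \<exists>\<rho> g. local_defining_function M p \<rho> g)"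

definition outward_unit_normal :: "'a::euclidean_space set \<Rightarrow> 'a \<Rightarrow> 'a"
  where "outward_unit_normal M p =
    (THE \<nu>. \<exists>\<rho> g. local_defining_function M p \<rho> g \<and> \<nu> = g /\<^sub>R norm g)"

text \<open>The derivative is taken from inside \<open>M\<close>, so it does not depend on the values of
  \<open>f\<close> outside \<open>M\<close>.\<close>

definition normal_deriv ::
    "'a::euclidean_space set \<Rightarrow> ('a \<Rightarrow> 'b::real_normed_vector) \<Rightarrow> 'a \<Rightarrow> 'b"
  where "normal_deriv M f p =
    vector_derivative (\<lambda>h::real. f (p + h *\<^sub>R outward_unit_normal M p)) (at 0 within {..0})"

definition wave_operator ::
    "(real \<times> 'a::euclidean_space \<Rightarrow> 'b::real_normed_vector) \<Rightarrow> real \<times> 'a \<Rightarrow> 'b"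
  where "wave_operator u =
    (\<lambda>q. dir_deriv (1, 0) (dir_deriv (1, 0) u) q
        - (\<Sum>b\<in>Basis. dir_deriv (0, b) (dir_deriv (0, b) u) q))"

text \<open>Functions are total; only the values on \<open>\<real> \<times> M\<close> matter. By continuity the equation
  at interior points gives it up to the boundary.\<close>

definition smooth_wave_solution ::
    "'a::euclidean_space set \<Rightarrow> (real \<times> 'a \<Rightarrow> complex) \<Rightarrow> bool"
  where "smooth_wave_solution M u \<longleftrightarrow>
    smooth_upto (UNIV \<times> M) u \<and>
    (\<forall>t. \<forall>x\<in>interior M. wave_operator u (t, x) = 0)"

text \<open>The \<open>H\<^sup>k\<close> norm on a bounded open set \<open>U\<close>, for functions which are smooth on \<open>U\<close> with
  bounded derivatives, so that weak derivatives are the classical ones and all the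
  integrals are finite. The inner sum is over all iterated partial derivatives of order
  at most \<open>k\<close>, one for each list of coordinate directions.\<close>

definition sobolev_norm ::
    "nat \<Rightarrow> 'a::euclidean_space set \<Rightarrow> ('a \<Rightarrow> 'b::real_normed_vector) \<Rightarrow> real"
  where "sobolev_norm k U f =
    sqrt (\<Sum>vs | set vs \<subseteq> Basis \<and> length vs \<le> k.
      set_lebesgue_integral lborel U (\<lambda>x. (norm (foldr dir_deriv vs f x))\<^sup>2))"

text \<open>The \<open>H\<^sup>k\<close> norm on \<open>I \<times> {cis \<theta> | \<theta> \<in> J}\<close>. Since \<open>cis\<close> parametrises the unit circle by
  arc length, it is the \<open>H\<^sup>k\<close> norm in the coordinates \<open>(t, \<theta>)\<close>.\<close>

definition arc_sobolev_norm ::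
    "nat \<Rightarrow> real set \<Rightarrow> real set \<Rightarrow> (real \<times> complex \<Rightarrow> complex) \<Rightarrow> real"
  where "arc_sobolev_norm k I J f = sobolev_norm k (I \<times> J) (\<lambda>(t, \<theta>). f (t, cis \<theta>))"

definition cauchy_data_norm ::
    "complex set \<Rightarrow> nat \<Rightarrow> real set \<Rightarrow> real set \<Rightarrow> (real \<times> complex \<Rightarrow> complex) \<Rightarrow> real"
  where "cauchy_data_norm M k I J u =
    sqrt ((arc_sobolev_norm k I J u)\<^sup>2
        + (arc_sobolev_norm (k - 1) I J (\<lambda>(t, x). normal_deriv M (\<lambda>y. u (t, y)) x))\<^sup>2)"

end

theory Submission
  imports Defs "HOL-Real_Asymp.Real_Asymp"
begin

text \<open>The time-independent functions \<open>u (t, z) = inverse z ^ n\<close> are smooth solutions, since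
  \<open>0 \<notin> M\<close>. On \<open>\<Gamma>\<close>, where \<open>\<bar>z\<bar> = 1\<close>, their Cauchy data are \<open>cis (- n \<theta>)\<close> and \<open>- n cis (- n \<theta>)\<close>,
  with norms of order \<open>n ^ k\<close>, whereas the \<open>L\<^sup>2\<close> norm over the part of \<open>\<Omega>\<close> in \<open>\<bar>z\<bar> < q < 1\<close>
  is at least of order \<open>q ^ (- n)\<close>.\<close>

section \<open>Directional derivatives and \<open>C_on\<close> as local notions on open sets\<close>

lemma dir_deriv_eqI: "(f has_derivative f') (at x) \<Longrightarrow> dir_deriv v f x = f' v"
  unfolding dir_deriv_def by (simp add: frechet_derivative_at[symmetric])

lemma dir_deriv_cong_open:
  assumes "open S" "x \<in> S" "\<And>y. y \<in> S \<Longrightarrow> f y = g y"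
  shows "dir_deriv v f x = dir_deriv v g x"
proof -
  \<comment> \<open>\<open>frechet_derivative\<close> is a choice among the derivatives at
    \<open>x\<close>. Equality of the two predicates makes the choices agree even where neither
    function is differentiable.\<close>
  have "(f has_derivative f') (at x) \<longleftrightarrow> (g has_derivative f') (at x)" for f'
    using has_derivative_transform_within_open[of f f' x UNIV S g]
      has_derivative_transform_within_open[of g f' x UNIV S f] assms by auto
  then show ?thesis
    unfolding dir_deriv_def frechet_derivative_def by simp
qed

lemma foldr_dir_deriv_cong_open:
  assumes "open S" "x \<in> S" "\<And>y. y \<in> S \<Longrightarrow> f y = g y"
  shows "foldr dir_deriv vs f x = foldr dir_deriv vs g x"
  using assms(2)
proof (induction vs arbitrary: x)
  case Nil
  then show ?case using assms(3) by simp
next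
  case (Cons v vs)
  then show ?case
    using dir_deriv_cong_open[OF assms(1), of x "foldr dir_deriv vs f" "foldr dir_deriv vs g"]
    by simp
qed

lemma C_on_cong:
  assumes "open S" "\<And>y. y \<in> S \<Longrightarrow> f y = g y" "C_on n S f"
  shows "C_on n S g"
  using assms(2,3)
proof (induction n arbitrary: f g)
  case 0
  then show ?case using continuous_on_cong[of S S f g] by simp
next
  case (Suc n)
  have "g differentiable (at x)" if "x \<in> S" for x
  proof -
    from Suc.prems(2) that obtain f' where "(f has_derivative f') (at x)"
      by (auto simp: differentiable_def)
    then have "(g has_derivative f') (at x)"
      using has_derivative_transform_within_open[of f f' x UNIV S g] assms(1) that Suc.prems(1)
      by auto
    then show ?thesis by (auto simp: differentiable_def)
  qed
  moreover have "C_on n S (dir_deriv v g)" for v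
  proof (rule Suc.IH)
    show "dir_deriv v f y = dir_deriv v g y" if "y \<in> S" for y
      using dir_deriv_cong_open[OF assms(1) that] Suc.prems(1) by blast
    show "C_on n S (dir_deriv v f)" using Suc.prems(2) by simp
  qed
  ultimately show ?case by simp
qed

section \<open>Crude upper and lower bounds for Sobolev norms\<close>

lemma set_integral_le_const:
  fixes f :: "'a \<Rightarrow> real"
  assumes U: "U \<in> sets M" "emeasure M U < \<infinity>" and f: "\<And>x. x \<in> U \<Longrightarrow> f x \<le> B" and B: "0 \<le> B"
  shows "set_lebesgue_integral M U f \<le> B * measure M U"
proof (cases "set_integrable M U f")
  case True
  have "set_integrable M U (\<lambda>x. B)"
    using U by (simp add: set_integrable_def)
  from set_integral_mono[OF True this f] show ?thesis
    using U by (simp add: set_lebesgue_integral_def mult.commute)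
next
  \<comment> \<open>The integral of a non-integrable function is 0 by convention, so
    \<open>0 \<le> B\<close> suffices; this spares later upper bounds any integrability
    proof.\<close>
  case False
  then show ?thesis
    using B by (simp add: set_lebesgue_integral_def set_integrable_def not_integrable_integral_eq)
qed

lemma finite_multiindices: "finite {vs :: 'a::euclidean_space list. set vs \<subseteq> Basis \<and> length vs \<le> k}"
  by (rule finite_lists_length_le) simp

lemma sobolev_norm_le:
  fixes U :: "'a::euclidean_space set" and f :: "'a \<Rightarrow> 'b::real_normed_vector"
  assumes U: "U \<in> sets lborel" "emeasure lborel U < \<infinity>" and B: "0 \<le> B"
    and le: "\<And>vs x. set vs \<subseteq> Basis \<Longrightarrow> length vs \<le> k \<Longrightarrow> x \<in> U \<Longrightarrow> norm (foldr dir_deriv vs f x) \<le> B"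
  shows "sobolev_norm k U f
    \<le> B * sqrt (card {vs :: 'a list. set vs \<subseteq> Basis \<and> length vs \<le> k} * measure lborel U)"
proof -
  have "(\<Sum>vs | set vs \<subseteq> Basis \<and> length vs \<le> k.
      set_lebesgue_integral lborel U (\<lambda>x. (norm (foldr dir_deriv vs f x))\<^sup>2))
    \<le> of_nat (card {vs :: 'a list. set vs \<subseteq> Basis \<and> length vs \<le> k}) * (B\<^sup>2 * measure lborel U)"
    by (rule sum_bounded_above, rule set_integral_le_const[OF U])
       (auto intro!: power_mono le)
  then have "sobolev_norm k U f
    \<le> sqrt (of_nat (card {vs :: 'a list. set vs \<subseteq> Basis \<and> length vs \<le> k}) * (B\<^sup>2 * measure lborel U))"
    unfolding sobolev_norm_def by simp
  also have "\<dots> = B * sqrt (card {vs :: 'a list. set vs \<subseteq> Basis \<and> length vs \<le> k} * measure lborel U)"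
    using B by (simp add: real_sqrt_mult)
  finally show ?thesis .
qed

text \<open>The empty list of directions contributes the squared \<open>L\<^sup>2\<close> norm of
  \<open>f\<close>, and all other terms are nonnegative. Unlike for the upper bound, integrability
  is assumed, which excludes the default value 0 of the integral.\<close>

lemma sobolev_norm_ge:
  fixes U :: "'a::euclidean_space set" and f :: "'a \<Rightarrow> 'b::real_normed_vector"
  assumes int: "set_integrable lborel U (\<lambda>x. (norm (f x))\<^sup>2)"
    and A: "A \<subseteq> U" "A \<in> sets lborel" "emeasure lborel A < \<infinity>"
    and c: "0 \<le> c" "\<And>x. x \<in> A \<Longrightarrow> c \<le> norm (f x)"
  shows "c * sqrt (measure lborel A) \<le> sobolev_norm k U f"
proof -
  let ?L = "{vs :: 'a list. set vs \<subseteq> Basis \<and> length vs \<le> k}"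
  let ?g = "\<lambda>vs. set_lebesgue_integral lborel U (\<lambda>x. (norm (foldr dir_deriv vs f x))\<^sup>2)"
  have "c\<^sup>2 * measure lborel A = set_lebesgue_integral lborel A (\<lambda>x. c\<^sup>2)"
    using A by (simp add: set_lebesgue_integral_def)
  also have "\<dots> \<le> set_lebesgue_integral lborel U (\<lambda>x. (norm (f x))\<^sup>2)"
    unfolding set_lebesgue_integral_def
  proof (rule integral_mono)
    show "integrable lborel (\<lambda>x. indicat_real A x *\<^sub>R c\<^sup>2)"
      using A by simp
    show "integrable lborel (\<lambda>x. indicat_real U x *\<^sub>R (norm (f x))\<^sup>2)"
      using int by (simp add: set_integrable_def)
    show "indicat_real A x *\<^sub>R c\<^sup>2 \<le> indicat_real U x *\<^sub>R (norm (f x))\<^sup>2" for x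
      using A(1) c by (auto simp: indicator_def intro!: power_mono)
  qed
  also have "\<dots> = ?g []"
    by simp
  also have "\<dots> \<le> sum ?g ?L"
    by (rule member_le_sum) (auto simp: finite_multiindices set_lebesgue_integral_def)
  finally have "sqrt (c\<^sup>2 * measure lborel A) \<le> sobolev_norm k U f"
    unfolding sobolev_norm_def by simp
  then show ?thesis
    using c(1) by (simp add: real_sqrt_mult)
qed

section \<open>The outward normal at boundary points on the unit sphere\<close>

text \<open>If the unit normal \<open>g'\<close> differed from \<open>p\<close>, the direction
  \<open>v = p - g'\<close> would enter \<open>M\<close>, since \<rho> decreases along it, and yet
  leave the unit ball at \<open>p\<close>, since \<open>p \<bullet> v > 0\<close>.\<close>

lemma local_defining_function_normal:
  fixes M :: "'a::euclidean_space set"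
  assumes M: "M \<subseteq> cball 0 1" and p: "norm p = 1" and ldf: "local_defining_function M p \<rho> g"
  shows "g /\<^sub>R norm g = p"
proof (rule ccontr)
  define g' where "g' = g /\<^sub>R norm g"
  define v where "v = p - g'"
  assume "g /\<^sub>R norm g \<noteq> p"
  then have "v \<noteq> 0" by (simp add: v_def g'_def)
  from ldf obtain V where V: "open V" "p \<in> V" "M \<inter> V = {x \<in> V. \<rho> x \<le> 0}"
    and \<rho>: "\<rho> p = 0" "GDERIV \<rho> p :> g" "g \<noteq> 0"
    unfolding local_defining_function_def by blast
  have "norm g' = 1" using \<rho>(3) by (simp add: g'_def)
  then have g1: "g' \<bullet> g' = 1" by (simp add: norm_eq_1)
  have p1: "p \<bullet> p = 1" using p by (simp add: norm_eq_1)
  \<comment> \<open>Here \<open>v \<bullet> v = 2 - 2 * (p \<bullet> g')\<close>, so this is the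
    strict Cauchy-Schwarz inequality for two distinct unit vectors.\<close>
  have "0 < v \<bullet> v" using \<open>v \<noteq> 0\<close> by simp
  then have pg: "p \<bullet> g' < 1"
    using g1 p1 by (simp add: v_def inner_diff_left inner_diff_right inner_commute)
  then have pv: "0 < p \<bullet> v"
    using p1 by (simp add: v_def inner_diff_right)
  have "g' \<bullet> v < 0"
    using pg g1 by (simp add: v_def inner_diff_right inner_commute)
  then have gv: "v \<bullet> g < 0"
    using \<rho>(3) by (simp add: g'_def inner_commute field_simps zero_less_mult_iff mult_less_0_iff)
  have "((\<lambda>h. \<rho> (p + h *\<^sub>R v)) has_derivative (\<lambda>h. (h *\<^sub>R v) \<bullet> g)) (at 0)"
  proof (rule has_derivative_compose[where f = "\<lambda>h. p + h *\<^sub>R v"])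
    show "((\<lambda>h. p + h *\<^sub>R v) has_derivative (\<lambda>h. h *\<^sub>R v)) (at 0)"
      by (auto intro!: derivative_eq_intros)
    show "(\<rho> has_derivative (\<lambda>x. x \<bullet> g)) (at (p + 0 *\<^sub>R v))"
      using \<rho>(2) by (simp add: gderiv_def inner_commute)
  qed
  then have "((\<lambda>h. \<rho> (p + h *\<^sub>R v)) has_field_derivative v \<bullet> g) (at 0)"
    by (rule has_derivative_imp_has_field_derivative) simp
  from DERIV_neg_dec_right[OF this gv] obtain d where d: "d > 0"
    "\<And>h. 0 < h \<Longrightarrow> h < d \<Longrightarrow> \<rho> (p + h *\<^sub>R v) < 0"
    using \<rho>(1) by auto
  from V(1,2) obtain e where e: "e > 0" "ball p e \<subseteq> V"
    by (auto simp: open_contains_ball)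
  \<comment> \<open>The first bound makes \<rho> negative at \<open>p + h *\<^sub>R v\<close>, the
    second keeps that point in the ball of radius \<open>e\<close> inside \<open>V\<close>.\<close>
  define h where "h = min (d / 2) (e / (2 * norm v))"
  have h: "0 < h" "h < d" using d(1) e(1) \<open>v \<noteq> 0\<close> by (auto simp: h_def)
  have "h * norm v \<le> e / (2 * norm v) * norm v"
    by (rule mult_right_mono) (auto simp: h_def)
  also have "\<dots> < e" using \<open>v \<noteq> 0\<close> e(1) by simp
  finally have "p + h *\<^sub>R v \<in> ball p e"
    using h(1) by (simp add: dist_norm)
  with e(2) have "p + h *\<^sub>R v \<in> {x \<in> V. \<rho> x \<le> 0}"
    using d(2)[OF h] by auto
  then have "p + h *\<^sub>R v \<in> M"
    unfolding V(3)[symmetric] by blast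
  then have "norm (p + h *\<^sub>R v) \<le> 1" using M by auto
  then have "(p + h *\<^sub>R v) \<bullet> (p + h *\<^sub>R v) \<le> 1"
    by (simp add: norm_le_square)
  \<comment> \<open>Expansion of the squared norm, with \<open>p \<bullet> p = 1\<close>
    cancelled.\<close>
  then have "2 * h * (p \<bullet> v) + h * h * (v \<bullet> v) \<le> 0"
    using p1 by (simp add: inner_add_left inner_add_right inner_commute algebra_simps)
  moreover have "0 < 2 * h * (p \<bullet> v)" "0 \<le> h * h * (v \<bullet> v)"
    using h pv by auto
  ultimately show False by linarith
qed

text \<open>For the \<open>THE\<close> in the definition, existence comes from the smooth boundary,
  and uniqueness from the previous lemma, which gives the same normal for every local defining
  function.\<close>

lemma outward_unit_normal_eq_point:
  fixes M :: "'a::euclidean_space set"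
  assumes "compact_smooth_domain M" "M \<subseteq> cball 0 1" "p \<in> frontier M" "norm p = 1"
  shows "outward_unit_normal M p = p"
  unfolding outward_unit_normal_def
proof (rule the_equality)
  from assms obtain \<rho> g where "local_defining_function M p \<rho> g"
    unfolding compact_smooth_domain_def by blast
  with local_defining_function_normal[OF assms(2,4) this]
  show "\<exists>\<rho> g. local_defining_function M p \<rho> g \<and> p = g /\<^sub>R norm g" by metis
next
  fix \<nu> assume "\<exists>\<rho> g. local_defining_function M p \<rho> g \<and> \<nu> = g /\<^sub>R norm g"
  then show "\<nu> = p"
    using local_defining_function_normal[OF assms(2,4)] by blast
qed

section \<open>Negative powers: smoothness, wave equation and normal derivative\<close>

text \<open>The coefficient \<open>A\<close> closes the family under directional derivatives off the
  origin, so that induction on the order of differentiation stays within it.\<close>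

definition neg_power :: "complex \<Rightarrow> nat \<Rightarrow> real \<times> complex \<Rightarrow> complex"
  where "neg_power A n q = A * inverse (snd q) ^ n"

lemma has_field_derivative_inverse_power:
  assumes "z \<noteq> (0::complex)"
  shows "((\<lambda>z. inverse z ^ n) has_field_derivative - of_nat n * inverse z ^ Suc n) (at z)"
  by (rule DERIV_cong[OF DERIV_power[OF DERIV_inverse[OF assms], of n]])
     \<comment> \<open>The power rule leaves the natural exponent \<open>n - 1\<close>, which
       truncates at \<open>n = 0\<close>.\<close>
     (cases n; simp add: algebra_simps)

lemma has_derivative_neg_power:
  assumes "snd q \<noteq> 0"
  shows "(neg_power A n has_derivative (\<lambda>h. neg_power (- of_nat n * A * snd h) (Suc n) q)) (at q)"
proof -
  have "((\<lambda>z. A * inverse z ^ n) has_derivative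
      (\<lambda>h. A * (- of_nat n * inverse (snd q) ^ Suc n) * h)) (at (snd q))"
    using DERIV_cmult[OF has_field_derivative_inverse_power[OF assms]]
    by (rule has_field_derivative_imp_has_derivative)
  from has_derivative_compose[OF has_derivative_snd[OF has_derivative_ident] this]
  have "((\<lambda>q. A * inverse (snd q) ^ n) has_derivative
      (\<lambda>h. A * (- of_nat n * inverse (snd q) ^ Suc n) * snd h)) (at q)" .
  then show ?thesis
    unfolding neg_power_def by (rule has_derivative_eq_rhs) (auto simp: algebra_simps)
qed

lemma dir_deriv_neg_power:
  "snd q \<noteq> 0 \<Longrightarrow> dir_deriv v (neg_power A n) q = neg_power (- of_nat n * A * snd v) (Suc n) q"
  by (rule dir_deriv_eqI[OF has_derivative_neg_power])

lemma open_nonzero: "open (UNIV \<times> - {0} :: (real \<times> complex) set)"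
  by (intro open_Times) auto

lemma smooth_on_neg_power: "smooth_on (UNIV \<times> - {0}) (neg_power A n)"
proof -
  have "C_on m (UNIV \<times> - {0}) (neg_power A n)" for m
  proof (induction m arbitrary: A n)
    case 0
    show ?case unfolding neg_power_def by (auto intro!: continuous_intros)
  next
    case (Suc m)
    have "C_on m (UNIV \<times> - {0}) (dir_deriv v (neg_power A n))" for v
      by (rule C_on_cong[OF open_nonzero _ Suc.IH]) (auto intro!: dir_deriv_neg_power[symmetric])
    moreover have "neg_power A n differentiable (at q)" if "q \<in> UNIV \<times> - {0}" for q
      using has_derivative_neg_power[of q A n] that unfolding differentiable_def by auto
    ultimately show ?case by simp
  qed
  then show ?thesis by (simp add: smooth_on_def)
qed

text \<open>Holomorphic functions are harmonic: a second derivative along \<open>v\<close> carries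
  the factor \<open>snd v * snd v\<close>, which is 0 for the time direction and sums to
  \<open>1 + \<i> * \<i> = 0\<close> over the two space directions.\<close>

lemma wave_operator_neg_power:
  assumes "x \<noteq> 0"
  shows "wave_operator (neg_power A n) (t, x) = 0"
proof -
  have "dir_deriv v (dir_deriv v (neg_power A n)) (t, x)
      = neg_power (of_nat n * of_nat (Suc n) * A * (snd v * snd v)) (Suc (Suc n)) (t, x)" for v
  proof -
    have "dir_deriv v (dir_deriv v (neg_power A n)) (t, x)
        = dir_deriv v (neg_power (- of_nat n * A * snd v) (Suc n)) (t, x)"
      \<comment> \<open>The formula for the inner derivative holds only off the origin, so it is
        inserted on the open set \<open>open_nonzero\<close>.\<close>
      by (rule dir_deriv_cong_open[OF open_nonzero _ dir_deriv_neg_power]) (use assms in auto)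
    also have "\<dots> = neg_power (of_nat n * of_nat (Suc n) * A * (snd v * snd v)) (Suc (Suc n)) (t, x)"
      using assms by (subst dir_deriv_neg_power) (auto simp: neg_power_def algebra_simps)
    finally show ?thesis .
  qed
  then show ?thesis
    by (simp add: wave_operator_def Basis_complex_def neg_power_def)
qed

lemma smooth_wave_solution_neg_power:
  assumes "0 \<notin> M"
  shows "smooth_wave_solution M (neg_power A n)"
proof -
  have "smooth_upto (UNIV \<times> M) (neg_power A n)"
    unfolding smooth_upto_def
    by (rule exI[of _ "UNIV \<times> - {0}"], rule exI[of _ "neg_power A n"])
       (use assms open_nonzero smooth_on_neg_power in auto)
  moreover have "wave_operator (neg_power A n) (t, x) = 0" if "x \<in> interior M" for t x
    using that assms interior_subset[of M] by (intro wave_operator_neg_power) auto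
  ultimately show ?thesis
    unfolding smooth_wave_solution_def by blast
qed

text \<open>With a radial normal, the chain rule along \<open>p + h *\<^sub>R p\<close> multiplies
  the complex derivative by \<open>p\<close>, which cancels the additional factor
  \<open>inverse p\<close>.\<close>

lemma normal_deriv_neg_power:
  assumes "outward_unit_normal M p = p" "p \<noteq> 0"
  shows "normal_deriv M (\<lambda>y. neg_power 1 n (t, y)) p = - of_nat n * inverse p ^ n"
proof -
  have "((\<lambda>h::real. p + h *\<^sub>R p) has_vector_derivative p) (at 0 within {..0})"
    by (auto intro!: derivative_eq_intros)
  moreover have "((\<lambda>z. inverse z ^ n) has_field_derivative - of_nat n * inverse p ^ Suc n)
      (at (p + 0 *\<^sub>R p) within (\<lambda>h::real. p + h *\<^sub>R p) ` {..0})"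
    by (rule has_field_derivative_at_within)
       (use has_field_derivative_inverse_power[OF assms(2), of n] in simp)
  ultimately have "((\<lambda>z. inverse z ^ n) \<circ> (\<lambda>h::real. p + h *\<^sub>R p) has_vector_derivative
      p * (- of_nat n * inverse p ^ Suc n)) (at 0 within {..0})"
    by (rule field_vector_diff_chain_within)
  moreover have "p * (- of_nat n * inverse p ^ Suc n) = - of_nat n * inverse p ^ n"
    using assms(2) by (simp add: field_simps)
  ultimately have "((\<lambda>h. neg_power 1 n (t, p + h *\<^sub>R p)) has_vector_derivative - of_nat n * inverse p ^ n)
      (at 0 within {..0})"
    by (simp only: o_def neg_power_def snd_conv mult_1)
  \<comment> \<open>One-sided derivatives are unique because 0 is a limit point of the half-line;
    only then does \<open>vector_derivative\<close> return the value found.\<close>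
  moreover have "at (0::real) within {..0} \<noteq> bot"
  proof -
    have "{..0} - {0::real} = {..<0}" by auto
    then show ?thesis by (simp add: at_within_eq_bot_iff)
  qed
  ultimately show ?thesis
    unfolding normal_deriv_def assms(1) by (rule vector_derivative_within[rotated])
qed

section \<open>Polynomial growth of the Cauchy data on the arc\<close>

text \<open>This is \<open>neg_power\<close> on the unit circle in the coordinates
  \<open>(t, \<theta>)\<close>, again with a coefficient that absorbs derivatives.\<close>

definition ang_wave :: "complex \<Rightarrow> nat \<Rightarrow> real \<times> real \<Rightarrow> complex"
  where "ang_wave A n q = A * cis (- (of_nat n * snd q))"

lemma dir_deriv_ang_wave:
  "dir_deriv v (ang_wave A n) = ang_wave (- \<i> * of_nat n * of_real (snd v) * A) n"
proof
  fix q :: "real \<times> real"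
  have "((\<lambda>q. - \<i> * of_nat n * of_real (snd q)) has_derivative
    (\<lambda>h. - \<i> * of_nat n * of_real (snd h))) (at q)"
    by (auto intro!: derivative_eq_intros)
  from has_derivative_mult_right[OF has_derivative_compose[OF this
      has_field_derivative_imp_has_derivative[OF DERIV_exp]], of A]
  have "((\<lambda>q. A * exp (- \<i> * of_nat n * of_real (snd q))) has_derivative
    (\<lambda>h. - \<i> * of_nat n * of_real (snd h) * A * exp (- \<i> * of_nat n * of_real (snd q)))) (at q)"
    by (rule has_derivative_eq_rhs) (auto simp: algebra_simps)
  moreover have "ang_wave A n = (\<lambda>q. A * exp (- \<i> * of_nat n * of_real (snd q)))" for A
    by (rule ext) (simp add: ang_wave_def cis_conv_exp algebra_simps)
  ultimately show "dir_deriv v (ang_wave A n) q = ang_wave (- \<i> * of_nat n * of_real (snd v) * A) n q"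
    by (simp add: dir_deriv_eqI)
qed

text \<open>A derivative along \<open>v\<close> multiplies the coefficient by
  \<open>- \<i> * n * snd v\<close>, of modulus at most \<open>n\<close> for a coordinate
  direction.\<close>

lemma norm_foldr_dir_deriv_ang_wave_le:
  assumes "set vs \<subseteq> Basis"
  shows "norm (foldr dir_deriv vs (ang_wave A n) q) \<le> norm A * real n ^ length vs"
proof -
  have "\<exists>B. foldr dir_deriv vs (ang_wave A n) = ang_wave B n \<and> norm B \<le> norm A * real n ^ length vs"
    using assms
  proof (induction vs)
    case (Cons v vs)
    then obtain B where B: "foldr dir_deriv vs (ang_wave A n) = ang_wave B n"
      "norm B \<le> norm A * real n ^ length vs" by auto
    have "\<bar>snd v\<bar> \<le> 1" using Cons.prems by (auto simp: Basis_prod_def)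
    then have "\<bar>snd v\<bar> * (real n * norm B) \<le> 1 * (real n * (norm A * real n ^ length vs))"
      using B(2) by (intro mult_mono) auto
    then show ?case
      by (intro exI[of _ "- \<i> * of_nat n * of_real (snd v) * B"])
         (simp add: B(1) dir_deriv_ang_wave norm_mult algebra_simps)
  qed auto
  then show ?thesis by (auto simp: ang_wave_def norm_mult)
qed

lemma arc_sobolev_norm_le:
  assumes I: "open I" "bounded I" and J: "open J" "bounded J" and n: "1 \<le> n"
    and f: "\<And>t \<theta>. \<theta> \<in> J \<Longrightarrow> f (t, cis \<theta>) = A * inverse (cis \<theta>) ^ n"
  shows "arc_sobolev_norm k I J f \<le> norm A * real n ^ k *
    sqrt (card {vs :: (real \<times> real) list. set vs \<subseteq> Basis \<and> length vs \<le> k} * measure lborel (I \<times> J))"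
  unfolding arc_sobolev_norm_def
proof (rule sobolev_norm_le)
  have IJ: "open (I \<times> J)" "bounded (I \<times> J)"
    using I J by (auto intro: open_Times bounded_Times)
  then show "I \<times> J \<in> sets lborel" "emeasure lborel (I \<times> J) < \<infinity>"
    using emeasure_bounded_finite by auto
  fix vs :: "(real \<times> real) list" and x :: "real \<times> real"
  assume vs: "set vs \<subseteq> Basis" "length vs \<le> k" and x: "x \<in> I \<times> J"
  \<comment> \<open>\<open>f\<close> is known only over \<open>J\<close>; openness of
    \<open>I \<times> J\<close> carries the agreement over to all derivatives.\<close>
  have "foldr dir_deriv vs (\<lambda>(t, \<theta>). f (t, cis \<theta>)) x = foldr dir_deriv vs (ang_wave A n) x"
    by (rule foldr_dir_deriv_cong_open[OF IJ(1) x]) (auto simp: f Complex.DeMoivre ang_wave_def)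
  then have "norm (foldr dir_deriv vs (\<lambda>(t, \<theta>). f (t, cis \<theta>)) x) \<le> norm A * real n ^ length vs"
    using norm_foldr_dir_deriv_ang_wave_le[OF vs(1)] by simp
  \<comment> \<open>Since \<open>n \<ge> 1\<close>, the lower orders are dominated by order
    \<open>k\<close>.\<close>
  also have "\<dots> \<le> norm A * real n ^ k"
    using vs(2) n by (intro mult_left_mono power_increasing) auto
  finally show "norm (foldr dir_deriv vs (\<lambda>(t, \<theta>). f (t, cis \<theta>)) x) \<le> norm A * real n ^ k" .
qed simp

lemma arc_sobolev_norm_nonneg: "0 \<le> arc_sobolev_norm k I J f"
  unfolding arc_sobolev_norm_def sobolev_norm_def
  by (intro real_sqrt_ge_zero sum_nonneg) (simp add: set_lebesgue_integral_def)

text \<open>The normal derivative brings an extra factor \<open>n\<close>, but is measured with one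
  derivative less, so both components grow at most like \<open>n ^ k\<close>. The constants depend
  on \<open>k\<close>, \<open>I\<close> and \<open>J\<close>, not on \<open>n\<close>.\<close>

lemma cauchy_data_norm_neg_power_le:
  assumes I: "open I" "bounded I" and J: "open J" "bounded J" and "1 \<le> k"
    and normal: "\<And>\<theta>. \<theta> \<in> J \<Longrightarrow> outward_unit_normal M (cis \<theta>) = cis \<theta>"
  obtains K where "\<And>n. 1 \<le> n \<Longrightarrow> cauchy_data_norm M k I J (neg_power 1 n) \<le> K * real n ^ k"
proof -
  define c where "c j = sqrt (card {vs :: (real \<times> real) list. set vs \<subseteq> Basis \<and> length vs \<le> j}
    * measure lborel (I \<times> J))" for j
  have "cauchy_data_norm M k I J (neg_power 1 n) \<le> (c k + c (k - 1)) * real n ^ k" if n: "1 \<le> n" for n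
  proof -
    let ?u = "neg_power 1 n"
    let ?v = "\<lambda>(t, x). normal_deriv M (\<lambda>y. ?u (t, y)) x"
    have "cauchy_data_norm M k I J ?u \<le> arc_sobolev_norm k I J ?u + arc_sobolev_norm (k - 1) I J ?v"
      unfolding cauchy_data_norm_def
      by (rule sqrt_sum_squares_le_sum) (rule arc_sobolev_norm_nonneg)+
    also have "arc_sobolev_norm k I J ?u \<le> norm (1::complex) * real n ^ k * c k"
      unfolding c_def by (rule arc_sobolev_norm_le[OF I J n]) (simp add: neg_power_def)
    also have "arc_sobolev_norm (k - 1) I J ?v
        \<le> norm (- of_nat n :: complex) * real n ^ (k - 1) * c (k - 1)"
      unfolding c_def by (rule arc_sobolev_norm_le[OF I J n]) (simp add: normal_deriv_neg_power normal)
    also have "norm (- of_nat n :: complex) * real n ^ (k - 1) = real n ^ k"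
      using \<open>1 \<le> k\<close> by (cases k) simp_all
    finally show ?thesis by (simp add: algebra_simps)
  qed
  then show thesis by (rule that)
qed

section \<open>Polar sectors, and exponential against polynomial growth\<close>

text \<open>As \<open>cos\<close> is strictly decreasing on \<open>[0, pi]\<close> and
  \<open>Re z = norm z * cos (Arg z)\<close>, the angle condition becomes a strict inequality
  between continuous functions of \<open>z\<close>. This form makes sectors visibly open.\<close>

lemma polar_sector_eq:
  assumes "0 \<le> a" "0 < \<theta>1" "\<theta>1 \<le> pi"
  shows "{rcis r \<theta> | r \<theta>. a < r \<and> r < b \<and> \<bar>\<theta>\<bar> < \<theta>1}
    = {z. a < norm z \<and> norm z < b \<and> norm z * cos \<theta>1 < Re z}" (is "?L = ?R")
proof (intro equalityI subsetI)
  fix z assume "z \<in> ?L"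
  then obtain r \<theta> where z: "z = rcis r \<theta>" "a < r" "r < b" "\<bar>\<theta>\<bar> < \<theta>1" by blast
  have "cos \<theta>1 < cos \<bar>\<theta>\<bar>"
    by (rule cos_monotone_0_pi) (use z assms in auto)
  then show "z \<in> ?R" using z assms(1) by simp
next
  fix z assume z: "z \<in> ?R"
  then have "0 < norm z" using assms(1) by auto
  moreover have "Re z = norm z * cos (Arg z)"
    using rcis_cmod_Arg[of z] by (metis Re_rcis)
  ultimately have "cos \<theta>1 < cos \<bar>Arg z\<bar>" using z by auto
  then have "\<bar>Arg z\<bar> < \<theta>1"
    using Arg_bounded[of z] assms by (subst (asm) cos_mono_less_eq) auto
  then show "z \<in> ?L" using z rcis_cmod_Arg[of z, symmetric] by blast
qed

lemma exponential_not_le_polynomial: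
  fixes b :: real
  assumes "1 < b" "0 < a"
  obtains n :: nat where "1 \<le> n" "K * real n ^ k < b ^ n * a"
proof -
  have "(\<lambda>n. K * (real n ^ k / b ^ n)) \<longlonglongrightarrow> K * 0"
    by (rule tendsto_mult_left) (use \<open>1 < b\<close> in real_asymp)
  then have "\<forall>\<^sub>F n in sequentially. K * (real n ^ k / b ^ n) < a"
    using order_tendstoD(2) \<open>0 < a\<close> by fastforce
  then have "\<forall>\<^sub>F n in sequentially. 1 \<le> n \<and> K * (real n ^ k / b ^ n) < a"
    using eventually_ge_at_top[of 1] by eventually_elim simp
  then obtain n where "1 \<le> n" "K * (real n ^ k / b ^ n) < a"
    using eventually_happens'[OF sequentially_bot] by blast
  moreover have "0 < b ^ n" using \<open>1 < b\<close> by simp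
  ultimately show thesis by (intro that[of n]) (auto simp: field_simps)
qed

section \<open>Refutation of the stability estimate\<close>

theorem mainTheorem2:
  fixes M :: "complex set" and \<theta>0 \<theta>1 \<epsilon> T s :: real and k :: nat
  defines "\<Gamma> \<equiv> {cis \<theta> | \<theta>. \<bar>\<theta>\<bar> < \<theta>0}"
    and "\<Omega> \<equiv> {rcis r \<theta> | r \<theta>. 1 - \<epsilon> < r \<and> r < 1 \<and> \<bar>\<theta>\<bar> < \<theta>1}"
    and "I \<equiv> {T - s<..<T + s}"
  assumes "0 < \<theta>0" and "\<theta>0 < pi / 2"
    and "compact_smooth_domain M"
    and "M \<subseteq> {rcis r \<theta> | r \<theta>. 0 < r \<and> r \<le> 1 \<and> \<bar>\<theta>\<bar> < pi / 2}"
    and "\<Gamma> \<subseteq> frontier M"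
    and "0 < \<theta>1" and "\<theta>1 \<le> \<theta>0"
    and "0 < \<epsilon>" and "\<Omega> \<subseteq> M"
    and "0 < s"
    and "1 \<le> k"
  shows "\<not> (\<exists>C>0. \<forall>u. smooth_wave_solution M u \<longrightarrow>
    sobolev_norm k (I \<times> \<Omega>) u \<le> C * cauchy_data_norm M k I {-\<theta>0<..<\<theta>0} u)"
proof
  let ?J = "{-\<theta>0<..<\<theta>0}"
  assume "\<exists>C>0. \<forall>u. smooth_wave_solution M u \<longrightarrow>
    sobolev_norm k (I \<times> \<Omega>) u \<le> C * cauchy_data_norm M k I ?J u"
  then obtain C where "C > 0" and C: "\<And>u. smooth_wave_solution M u \<Longrightarrow>
    sobolev_norm k (I \<times> \<Omega>) u \<le> C * cauchy_data_norm M k I ?J u" by blast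
  have "M \<subseteq> cball 0 1" and M0: "0 \<notin> M"
    using assms(7) by (auto simp: subset_iff)
  \<comment> \<open>On the arc the normal is radial: these are boundary points of \<open>M\<close>
    on the unit circle, and \<open>M\<close> lies in the closed unit disc.\<close>
  have "outward_unit_normal M (cis \<theta>) = cis \<theta>" if "\<theta> \<in> ?J" for \<theta>
  proof (rule outward_unit_normal_eq_point)
    show "cis \<theta> \<in> frontier M" using assms(8) that unfolding \<Gamma>_def by force
  qed (use \<open>M \<subseteq> cball 0 1\<close> assms(6) in auto)
  then obtain K where K: "\<And>n. 1 \<le> n \<Longrightarrow> cauchy_data_norm M k I ?J (neg_power 1 n) \<le> K * real n ^ k"
    using cauchy_data_norm_neg_power_le[of I ?J k M] assms(14) unfolding I_def by auto

  have "\<epsilon> \<le> 1"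
  proof (rule ccontr)
    assume "\<not> \<epsilon> \<le> 1"
    then have "rcis 0 0 \<in> \<Omega>" using \<open>0 < \<theta>1\<close> unfolding \<Omega>_def
      by (intro CollectI exI[of _ 0]) auto
    then show False using \<open>\<Omega> \<subseteq> M\<close> M0 by auto
  qed
  have \<Omega>_eq: "\<Omega> = {z. 1 - \<epsilon> < norm z \<and> norm z < 1 \<and> norm z * cos \<theta>1 < Re z}"
    unfolding \<Omega>_def by (rule polar_sector_eq) (use \<open>\<epsilon> \<le> 1\<close> assms in auto)
  \<comment> \<open>The radius halfway between \<open>1 - \<epsilon>\<close> and 1: the part of
    \<Omega> inside it stays away from the unit circle and is still nonempty.\<close>
  define q where "q = 1 - \<epsilon> / 2"
  have q: "0 < q" "q < 1" using \<open>\<epsilon> \<le> 1\<close> \<open>0 < \<epsilon>\<close> by (auto simp: q_def)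
  define A where "A = I \<times> {z \<in> \<Omega>. norm z < q}"
  have "{z \<in> \<Omega>. norm z < q} = {z. 1 - \<epsilon> < norm z} \<inter> {z. norm z < q} \<inter> {z. norm z * cos \<theta>1 < Re z}"
    using q by (auto simp: \<Omega>_eq)
  then have "open {z \<in> \<Omega>. norm z < q}"
    by (auto intro!: open_Int open_Collect_less continuous_intros)
  then have "open A" unfolding A_def I_def by (intro open_Times) auto
  have "open \<Omega>"
    unfolding \<Omega>_eq by (intro open_Collect_conj open_Collect_less continuous_intros)
  then have "open (I \<times> \<Omega>)" unfolding I_def by (intro open_Times) auto
  then have U: "I \<times> \<Omega> \<in> sets lborel" by simp
  have "compact M" using assms(6) by (simp add: compact_smooth_domain_def)
  have "bounded A"
    unfolding A_def I_def
    by (rule bounded_Times) (use \<open>\<Omega> \<subseteq> M\<close> \<open>compact M\<close> in \<open>auto intro: bounded_subset compact_imp_bounded\<close>)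
  have A_fin: "A \<in> sets lborel" "emeasure lborel A < \<infinity>"
    using \<open>open A\<close> \<open>bounded A\<close> emeasure_bounded_finite by auto
  \<comment> \<open>The midpoint of \<open>1 - \<epsilon>\<close> and \<open>q\<close>. On the
    positive real axis \<open>Re z = norm z\<close>, so \<open>cos \<theta>1 < 1\<close> places it
    in the sector; hence the open set \<open>A\<close> is nonempty and has positive measure.\<close>
  have "1 - 3 / 4 * \<epsilon> \<in> {1 - \<epsilon><..<q}" "0 < 1 - 3 / 4 * \<epsilon>"
    using \<open>0 < \<epsilon>\<close> \<open>\<epsilon> \<le> 1\<close> by (auto simp: q_def)
  moreover have "cos \<theta>1 < 1"
    using cos_monotone_0_pi[of 0 \<theta>1] assms by simp
  ultimately have "(T, of_real (1 - 3 / 4 * \<epsilon>)) \<in> A"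
    using \<open>0 < s\<close> q unfolding A_def I_def \<Omega>_eq by (simp del: of_real_diff)
  then have "\<not> negligible A" using open_not_negligible \<open>open A\<close> by blast
  moreover have "A \<in> lmeasurable"
    using \<open>open A\<close> \<open>bounded A\<close> by (rule lmeasurable_open[rotated])
  ultimately have "measure lebesgue A \<noteq> 0"
    using negligible_iff_measure0 by blast
  then have A_pos: "0 < sqrt (measure lborel A)"
    using A_fin by (simp add: measure_completion zero_less_measure_iff)

  have lower: "inverse q ^ n * sqrt (measure lborel A) \<le> sobolev_norm k (I \<times> \<Omega>) (neg_power 1 n)" for n
  proof (rule sobolev_norm_ge)
    \<comment> \<open>Integrability on \<open>I \<times> \<Omega>\<close> is inherited from a
      compact superset on which the function is continuous, as the origin is not in
      \<open>M\<close>.\<close>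
    have "continuous_on ({T - s..T + s} \<times> M) (\<lambda>x. (norm (neg_power 1 n x))\<^sup>2)"
      unfolding neg_power_def using M0 by (auto intro!: continuous_intros)
    then have "set_integrable lborel ({T - s..T + s} \<times> M) (\<lambda>x. (norm (neg_power 1 n x))\<^sup>2)"
      unfolding set_integrable_def
      by (intro borel_integrable_compact compact_Times compact_Icc \<open>compact M\<close>)
    then show "set_integrable lborel (I \<times> \<Omega>) (\<lambda>x. (norm (neg_power 1 n x))\<^sup>2)"
      by (rule set_integrable_subset[OF _ U]) (use \<open>\<Omega> \<subseteq> M\<close> in \<open>auto simp: I_def\<close>)
    show "inverse q ^ n \<le> norm (neg_power 1 n x)" if "x \<in> A" for x
    proof -
      have "snd x \<in> M" "norm (snd x) < q" using that \<open>\<Omega> \<subseteq> M\<close> by (auto simp: A_def)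
      then have "inverse q \<le> inverse (norm (snd x))"
        using M0 by (intro le_imp_inverse_le) auto
      then show ?thesis
        using q by (simp add: neg_power_def norm_power norm_inverse power_mono)
    qed
  qed (use A_fin q in \<open>auto simp: A_def\<close>)

  have "1 < inverse q" using q by (simp add: one_less_inverse)
  \<comment> \<open>The bound \<open>K * n ^ k\<close> on the Cauchy data and the constant
    \<open>C\<close> are fixed before \<open>n\<close> is chosen, so exponential growth overtakes
    their product.\<close>
  then obtain n where n: "1 \<le> n" "C * K * real n ^ k < inverse q ^ n * sqrt (measure lborel A)"
    using exponential_not_le_polynomial A_pos by blast
  note lower[of n]
  also have "sobolev_norm k (I \<times> \<Omega>) (neg_power 1 n) \<le> C * cauchy_data_norm M k I ?J (neg_power 1 n)"
    by (rule C[OF smooth_wave_solution_neg_power[OF M0]])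
  also have "\<dots> \<le> C * (K * real n ^ k)"
    using K[OF n(1)] \<open>C > 0\<close> by simp
  finally show False using n(2) by simp
qed

end
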